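(* Let $\alpha\in (0,1)$ be fixed. Suppose that there is an infinite collection of Steiner quadruple systems (with infinitely many different numbers of points $n$) such that each system in the collection, on $n$ points say, has an $\lfloor \alpha n\rfloor$-good sequencing. Then $\alpha\leq 1/\sqrt{6}<0.41$.
   Context: A Steiner quadruple system on $n$ points is a set $V$ with $|V|=n$ together with a set of $4$-subsets of $V$, called blocks, such that every $3$-subset of $V$ is contained in a unique block. A sequencing of $V$ is a sequence $x_1,\ldots,x_n$ in which every element of $V$ occurs exactly once. A segment is a subsequence of consecutive entries. A sequencing is $\ell$-good if no segment of length at most $\ell$ contains all the points of a block. *)

theory Defs
  imports Complex_Main "HOL-Library.Sublist"
begin

definition steiner_quadruple_system :: "nat \<Rightarrow> 'a set \<Rightarrow> 'a set set \<Rightarrow> bool" where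
  "steiner_quadruple_system n V B \<longleftrightarrow>
     finite V \<and> card V = n \<and>
     (\<forall>b\<in>B. b \<subseteq> V \<and> card b = 4) \<and>
     (\<forall>T. T \<subseteq> V \<and> card T = 3 \<longrightarrow> (\<exists>!b. b \<in> B \<and> T \<subseteq> b))"

definition sequencing :: "'a set \<Rightarrow> 'a list \<Rightarrow> bool" where
  "sequencing V xs \<longleftrightarrow> distinct xs \<and> set xs = V"

(* In HOL-Library.Sublist, sublist means a contiguous sublist, i.e. a segment
   (arbitrary subsequences are called subseq there). *)
definition good :: "nat \<Rightarrow> 'a set set \<Rightarrow> 'a list \<Rightarrow> bool" where
  "good l B xs \<longleftrightarrow>
     \<not> (\<exists>s b. sublist s xs \<and> length s \<le> l \<and> b \<in> B \<and> b \<subseteq> set s)"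

end

theory Submission
  imports Defs
begin

text \<open>
  Fix a point \<open>x\<close> of an \<open>l\<close>-good sequencing and let \<open>L\<close> and \<open>R\<close> consist of the \<open>m\<close> points just
  before and just after \<open>x\<close>, where \<open>m + 1 \<le> l\<close>. Each pair of points from \<open>L\<close> together with \<open>x\<close>
  lies in a unique block, and likewise for \<open>R\<close>. All these blocks are
  distinct: a block through \<open>x\<close> that contains two pairs from \<open>L\<close> is contained in \<open>L \<union> {x}\<close>, which
  is a segment of length \<open>m + 1\<close>; the same holds for \<open>R\<close>; and a block that contains \<open>x\<close>, a pair
  from \<open>L\<close> and a pair from \<open>R\<close> has five points. So at least \<open>2 * (m choose 2)\<close> blocks pass
  through \<open>x\<close>. On the other hand the blocks through \<open>x\<close> induce a triple system on the remaining
  \<open>n - 1\<close> points, in which no pair is covered twice, so there are at most \<open>((n - 1) choose 2) / 3\<close>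
  of them. Asymptotically this says \<open>m^2 \<le> n^2 / 6\<close>.

  The point \<open>x\<close> exists as soon as \<open>2 * m + 1 \<le> n\<close>. Since goodness passes to smaller lengths, it is
  harmless to take \<open>m\<close> close to \<open>\<beta> * n\<close> with \<open>\<beta> = min \<alpha> (9/20)\<close>, where \<open>9/20\<close> is a number
  strictly between \<open>1 / sqrt 6\<close> and \<open>1/2\<close>.
\<close>

lemma block_through_triple:
  assumes "steiner_quadruple_system n V B" "T \<subseteq> V" "card T = 3"
  shows "\<exists>!b. b \<in> B \<and> T \<subseteq> b"
  using assms by (simp only: steiner_quadruple_system_def)

lemma blocks_eq_if_three_common:
  assumes sqs: "steiner_quadruple_system n V B"
    and "b \<in> B" "c \<in> B" "T \<subseteq> b" "T \<subseteq> c" "card T = 3"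
  shows "b = c"
proof -
  have "b \<subseteq> V"
    using sqs \<open>b \<in> B\<close> by (simp add: steiner_quadruple_system_def)
  then have "T \<subseteq> V" using \<open>T \<subseteq> b\<close> by simp
  then have "\<exists>!b. b \<in> B \<and> T \<subseteq> b"
    using block_through_triple[OF sqs] \<open>card T = 3\<close> by simp
  then show ?thesis using assms by blast
qed

text \<open>The triples \<open>b - {x}\<close> cover three pairs each, and no pair is covered twice.\<close>

lemma card_blocks_through_point:
  assumes sqs: "steiner_quadruple_system n V B" and "x \<in> V"
  shows "finite {b \<in> B. x \<in> b}" "3 * card {b \<in> B. x \<in> b} \<le> (n - 1) choose 2"
proof -
  let ?Bx = "{b \<in> B. x \<in> b}"
  let ?pairs = "\<lambda>A. {p. p \<subseteq> A \<and> card p = 2}"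
  have V: "finite V" "card V = n" and b: "\<And>b. b \<in> B \<Longrightarrow> b \<subseteq> V \<and> card b = 4"
    using sqs unfolding steiner_quadruple_system_def by auto
  have "?Bx \<subseteq> Pow V" using b by auto
  then show fin: "finite ?Bx" using V(1) finite_subset by blast
  have card_pairs: "card (?pairs (b - {x})) = 3" and fin_pairs: "finite (?pairs (b - {x}))"
    if "b \<in> ?Bx" for b
  proof -
    have "finite b" using that b V(1) finite_subset by blast
    then show "finite (?pairs (b - {x}))" by simp
    have "card (b - {x}) = 3" using that b by simp
    then show "card (?pairs (b - {x})) = 3"
      using n_subsets[of "b - {x}" 2] \<open>finite b\<close> by (simp add: choose_two)
  qed
  have disj: "?pairs (b - {x}) \<inter> ?pairs (c - {x}) = {}"
    if "b \<in> ?Bx" "c \<in> ?Bx" "b \<noteq> c" for b c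
  proof -
    have False if p: "p \<subseteq> b - {x}" "p \<subseteq> c - {x}" "card p = 2" for p
    proof -
      have "finite p" using p(3) card.infinite by fastforce
      moreover have "x \<notin> p" using p by auto
      ultimately have "card (insert x p) = 3" using p(3) by simp
      then show False
        using blocks_eq_if_three_common[OF sqs, of b c "insert x p"] p
          \<open>b \<in> ?Bx\<close> \<open>c \<in> ?Bx\<close> \<open>b \<noteq> c\<close> by auto
    qed
    then show ?thesis by blast
  qed
  have "card (\<Union>b\<in>?Bx. ?pairs (b - {x})) = (\<Sum>b\<in>?Bx. card (?pairs (b - {x})))"
    using fin fin_pairs disj by (intro card_UN_disjoint) blast+
  also have "\<dots> = (\<Sum>b\<in>?Bx. 3)" using card_pairs by (intro sum.cong) auto
  finally have "3 * card ?Bx = card (\<Union>b\<in>?Bx. ?pairs (b - {x}))" by simp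
  also have "\<dots> \<le> card (?pairs (V - {x}))"
  proof (rule card_mono)
    show "finite (?pairs (V - {x}))" using V(1) by simp
    show "(\<Union>b\<in>?Bx. ?pairs (b - {x})) \<subseteq> ?pairs (V - {x})" using b by blast
  qed
  also have "\<dots> = (n - 1) choose 2"
    using n_subsets[of "V - {x}" 2] V \<open>x \<in> V\<close> by simp
  finally show "3 * card ?Bx \<le> (n - 1) choose 2" .
qed

text \<open>
  The heart of the argument: assigning to a pair on either side of \<open>x\<close> the block through it and
  \<open>x\<close> is injective, because two different pairs and \<open>x\<close> already account for at least four points.
\<close>

lemma card_pairs_beside_point_le:
  assumes sqs: "steiner_quadruple_system n V B"
    and "x \<in> V" "L \<subseteq> V" "R \<subseteq> V" "x \<notin> L" "x \<notin> R" "L \<inter> R = {}"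
    and noL: "\<And>b. b \<in> B \<Longrightarrow> \<not> b \<subseteq> insert x L"
    and noR: "\<And>b. b \<in> B \<Longrightarrow> \<not> b \<subseteq> insert x R"
  shows "3 * ((card L choose 2) + (card R choose 2)) \<le> (n - 1) choose 2"
proof -
  let ?pairs = "\<lambda>A. {p. p \<subseteq> A \<and> card p = 2}"
  let ?Q = "?pairs L \<union> ?pairs R"
  have V: "finite V" and b: "\<And>b. b \<in> B \<Longrightarrow> b \<subseteq> V \<and> card b = 4"
    using sqs unfolding steiner_quadruple_system_def by auto
  have fin: "finite L" "finite R"
    using finite_subset[OF \<open>L \<subseteq> V\<close> V] finite_subset[OF \<open>R \<subseteq> V\<close> V] by auto
  have pair: "finite p \<and> x \<notin> p \<and> p \<subseteq> V \<and> card p = 2" if "p \<in> ?Q" for p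
    using that fin assms(3-6) by (auto intro: finite_subset)
  have "\<exists>b. b \<in> B \<and> insert x p \<subseteq> b" if "p \<in> ?Q" for p
  proof -
    have "insert x p \<subseteq> V" "card (insert x p) = 3"
      using pair[OF that] \<open>x \<in> V\<close> by simp_all
    then show ?thesis by (rule block_through_triple[OF sqs, THEN ex1_implies_ex])
  qed
  then have "\<forall>p\<in>?Q. \<exists>b. b \<in> B \<and> insert x p \<subseteq> b" by (intro ballI)
  then obtain blk where blk_all: "\<forall>p\<in>?Q. blk p \<in> B \<and> insert x p \<subseteq> blk p"
    by (rule bchoice[THEN exE])
  have blk: "blk p \<in> B \<and> insert x p \<subseteq> blk p" if "p \<in> ?Q" for p
    using blk_all that by (rule bspec)
  have inj: "inj_on blk ?Q"
  proof (rule inj_onI, rule ccontr)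
    fix p q assume p: "p \<in> ?Q" and q: "q \<in> ?Q" and eq: "blk p = blk q" and "p \<noteq> q"
    let ?b = "blk p"
    have fp: "finite p" "card p = 2" and fq: "finite q" "card q = 2"
      using pair[OF p] pair[OF q] by auto
    have b4: "?b \<in> B" "card ?b = 4" "finite ?b"
      using blk[OF p] b finite_subset[OF _ V] by simp_all
    have sub: "insert x (p \<union> q) \<subseteq> ?b" using blk[OF p] blk[OF q] eq by auto
    have "p \<subset> p \<union> q"
      using \<open>p \<noteq> q\<close> fp fq card_subset_eq[of p q] by auto
    then have "card p < card (p \<union> q)"
      using fp fq by (intro psubset_card_mono) auto
    moreover have "card (insert x (p \<union> q)) = Suc (card (p \<union> q))"
      using fp fq pair[OF p] pair[OF q] by simp
    ultimately have "card (insert x (p \<union> q)) = card ?b" "card (p \<union> q) = 3"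
      using card_mono[OF b4(3) sub] b4(2) fp(2) by linarith+
    then have b_eq: "?b = insert x (p \<union> q)"
      using card_subset_eq[OF b4(3) sub] by simp
    \<comment> \<open>The third case is the five-point one; pairs that meet are on the same side of \<open>x\<close>.\<close>
    consider "p \<union> q \<subseteq> L" | "p \<union> q \<subseteq> R" | "p \<inter> q = {}"
    proof -
      have "p \<subseteq> L \<or> p \<subseteq> R" "q \<subseteq> L \<or> q \<subseteq> R" using p q by fast+
      then show thesis using that \<open>L \<inter> R = {}\<close> by fast
    qed
    then show False
    proof cases
      case 1 then show False using noL[OF b4(1)] b_eq by blast
    next
      case 2 then show False using noR[OF b4(1)] b_eq by blast
    next
      case 3 then show False
        using \<open>card (p \<union> q) = 3\<close> card_Un_disjoint[OF fp(1) fq(1)] fp(2) fq(2) by simp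
    qed
  qed
  have "?pairs L \<inter> ?pairs R = {}"
  proof -
    have False if "p \<subseteq> L" "p \<subseteq> R" "card p = 2" for p
    proof -
      have "p = {}" using that \<open>L \<inter> R = {}\<close> by blast
      then show False using \<open>card p = 2\<close> by simp
    qed
    then show ?thesis by blast
  qed
  then have "(card L choose 2) + (card R choose 2) = card ?Q"
    using fin by (simp add: card_Un_disjoint n_subsets)
  also have "\<dots> = card (blk ` ?Q)" by (rule card_image[OF inj, symmetric])
  also have "\<dots> \<le> card {b \<in> B. x \<in> b}"
    using card_blocks_through_point(1)[OF sqs \<open>x \<in> V\<close>] blk by (intro card_mono) auto
  finally have "3 * ((card L choose 2) + (card R choose 2)) \<le> 3 * card {b \<in> B. x \<in> b}"
    by (rule mult_le_mono2)
  also have "\<dots> \<le> (n - 1) choose 2" by (rule card_blocks_through_point(2)[OF sqs \<open>x \<in> V\<close>])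
  finally show ?thesis .
qed

lemma good_sequencing_choose_bound:
  assumes sqs: "steiner_quadruple_system n V B"
    and seq: "sequencing V xs" and good: "good l B xs"
    and "Suc m \<le> l" "2 * m + 1 \<le> n"
  shows "6 * (m choose 2) \<le> (n - 1) choose 2"
proof -
  define us x vs zs where "us = take m xs" and "x = xs ! m"
    and "vs = take m (drop (Suc m) xs)" and "zs = drop m (drop (Suc m) xs)"
  have xs: "distinct xs" "set xs = V" using seq unfolding sequencing_def by auto
  have "card V = n" using sqs unfolding steiner_quadruple_system_def by blast
  then have len: "length xs = n" using xs distinct_card by metis
  then have split: "xs = us @ x # vs @ zs"
    using \<open>2 * m + 1 \<le> n\<close> unfolding us_def x_def vs_def zs_def
    by (simp add: id_take_nth_drop[symmetric] del: drop_drop)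
  have lens: "length us = m" "length vs = m"
    using len \<open>2 * m + 1 \<le> n\<close> unfolding us_def vs_def by auto
  have dist: "distinct us" "distinct vs" "x \<notin> set us" "x \<notin> set vs" "set us \<inter> set vs = {}"
    using xs(1) unfolding split by auto
  have sub: "x \<in> V" "set us \<subseteq> V" "set vs \<subseteq> V"
    using xs(2) unfolding split by auto
  have seg: "sublist (us @ [x]) xs" "sublist (x # vs) xs"
    using sublist_appendI[of "us @ [x]" "[]" "vs @ zs"] sublist_appendI[of "x # vs" us zs]
    unfolding split by simp_all
  have no_block: "\<not> b \<subseteq> set s" if "b \<in> B" "sublist s xs" "length s = Suc m" for b s
    using good that \<open>Suc m \<le> l\<close> unfolding good_def by auto
  have "3 * ((card (set us) choose 2) + (card (set vs) choose 2)) \<le> (n - 1) choose 2"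
  proof (rule card_pairs_beside_point_le[OF sqs sub dist(3-5)])
    fix b assume "b \<in> B"
    show "\<not> b \<subseteq> insert x (set us)"
      using no_block[OF \<open>b \<in> B\<close> seg(1)] lens by simp
    show "\<not> b \<subseteq> insert x (set vs)"
      using no_block[OF \<open>b \<in> B\<close> seg(2)] lens by simp
  qed
  then show ?thesis using dist(1,2) lens by (simp add: distinct_card)
qed

text \<open>
  The choice \<open>m = \<lfloor>\<beta> * n\<rfloor> - 1\<close>, together with the crude estimates \<open>m - 1 \<ge> \<beta> * n - 3\<close> and
  \<open>m * (m - 1) \<ge> (m - 1)^2\<close>, turns the counting bound into one on \<open>n\<close> when \<open>\<beta> > 1 / sqrt 6\<close>.
\<close>

lemma good_sequencing_linear_bound:
  fixes \<beta> :: real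
  assumes sqs: "steiner_quadruple_system n V B"
    and "sequencing V xs" "good l B xs"
    and "\<beta> \<le> 1 / 2" "\<lfloor>\<beta> * real n\<rfloor> \<le> int l"
  shows "(\<beta> - 1 / sqrt 6) * real n \<le> 3"
proof (cases "\<beta> * real n < 3")
  case True
  moreover have "0 \<le> 1 / sqrt 6 * real n" by simp
  ultimately show ?thesis unfolding left_diff_distrib by linarith
next
  case False
  define k where "k = nat \<lfloor>\<beta> * real n\<rfloor>"
  define m where "m = k - 1"
  have k: "real k \<le> \<beta> * real n" "\<beta> * real n < real k + 1" "k \<ge> 3"
    using False unfolding k_def by linarith+
  have "k \<le> l" using assms(5) k_def by linarith
  moreover have "\<beta> * real n \<le> real n / 2"
    using mult_right_mono[OF \<open>\<beta> \<le> 1 / 2\<close>, of "real n"] by simp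
  then have "2 * k \<le> n" using k(1) by linarith
  ultimately have "6 * (m choose 2) \<le> (n - 1) choose 2"
    using good_sequencing_choose_bound[OF assms(1-3), of m] k(3) unfolding m_def by simp
  moreover have two_choose: "2 * (j choose 2) = j * (j - 1)" for j :: nat
    unfolding choose_two by (rule dvd_mult_div_cancel) (cases j; simp)
  ultimately have "6 * (m * (m - 1)) \<le> (n - 1) * (n - 1 - 1)"
    using two_choose[of m] two_choose[of "n - 1"] by linarith
  also have "\<dots> \<le> n * n" by (intro mult_mono) auto
  finally have "6 * (m * (m - 1)) \<le> n * n" .
  moreover have "(m - 1) * (m - 1) \<le> m * (m - 1)" by simp
  ultimately have "6 * ((m - 1) * (m - 1)) \<le> n * n" by linarith
  then have "real (6 * ((m - 1) * (m - 1))) \<le> real (n * n)" by (rule of_nat_mono)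
  then have "(sqrt 6 * real (m - 1))\<^sup>2 \<le> (real n)\<^sup>2"
    by (simp add: power_mult_distrib flip: power2_eq_square)
  then have "sqrt 6 * real (m - 1) \<le> real n"
    using power2_le_imp_le by fastforce
  then have "real (m - 1) \<le> real n / sqrt 6"
    by (simp add: field_simps)
  moreover have "real (m - 1) \<ge> \<beta> * real n - 3"
    using k unfolding m_def by linarith
  ultimately show ?thesis by (simp add: algebra_simps)
qed

theorem corollary18:
  fixes \<alpha> :: real and C :: "('a set \<times> 'a set set) set"
  assumes "0 < \<alpha>" and "\<alpha> < 1"
    and "\<And>V B. (V, B) \<in> C \<Longrightarrow> steiner_quadruple_system (card V) V B"
    and "infinite {card V | V B. (V, B) \<in> C}"
    and "\<And>V B. (V, B) \<in> C \<Longrightarrow>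
           \<exists>xs. sequencing V xs \<and> good (nat \<lfloor>\<alpha> * real (card V)\<rfloor>) B xs"
  shows "\<alpha> \<le> 1 / sqrt 6 \<and> 1 / sqrt 6 < (0.41 :: real)"
proof
  have "1 / 0.41 < sqrt (6 :: real)"
    by (rule real_less_rsqrt) (simp add: power2_eq_square)
  then show less: "1 / sqrt 6 < (0.41 :: real)" by (simp add: field_simps)
  show "\<alpha> \<le> 1 / sqrt 6"
  proof (rule ccontr)
    assume "\<not> \<alpha> \<le> 1 / sqrt 6"
    define \<beta> where "\<beta> = min \<alpha> (9 / 20)"
    have \<beta>: "\<beta> \<le> 1 / 2" "\<beta> \<le> \<alpha>" "\<beta> - 1 / sqrt 6 > 0"
      using \<open>\<not> \<alpha> \<le> 1 / sqrt 6\<close> less unfolding \<beta>_def by auto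
    define N where "N = nat \<lceil>3 / (\<beta> - 1 / sqrt 6)\<rceil>"
    have "card V \<le> N" if VB: "(V, B) \<in> C" for V B
    proof -
      obtain xs where xs: "sequencing V xs" "good (nat \<lfloor>\<alpha> * real (card V)\<rfloor>) B xs"
        using assms(5)[OF VB] by blast
      have "\<lfloor>\<beta> * real (card V)\<rfloor> \<le> \<lfloor>\<alpha> * real (card V)\<rfloor>"
        using \<beta>(2) by (intro floor_mono mult_right_mono) auto
      then have "(\<beta> - 1 / sqrt 6) * real (card V) \<le> 3"
        using good_sequencing_linear_bound[OF assms(3)[OF VB] xs \<beta>(1)] by linarith
      then have "real (card V) \<le> 3 / (\<beta> - 1 / sqrt 6)"
        using \<beta>(3) by (simp only: pos_le_divide_eq mult.commute)
      then show ?thesis unfolding N_def by linarith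
    qed
    then have "{card V | V B. (V, B) \<in> C} \<subseteq> {..N}" by auto
    then have "finite {card V | V B. (V, B) \<in> C}" by (rule finite_subset) simp
    then show False using assms(4) by simp
  qed
qed

end
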